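(* Let $\mathcal{M}=\langle Q,A,\delta\rangle$ be an MDP with $n=|Q|$ states, let $\alpha$ be the smallest positive probability in the transitions of $\mathcal{M}$, let $T\subseteq Q$, let $d_0$ be an initial distribution with smallest positive probability $\alpha_0$, and let $\epsilon_e=\alpha_0\cdot\alpha^{(n+1)\cdot 2^{n}}$. If $d_0$ is not limit-sure eventually synchronizing in $T$ (i.e. it is not the case that for every $\epsilon>0$ there exist a strategy $\sigma$ and $i\ge 0$ with $\mathcal{M}^{\sigma}_i(T)\ge 1-\epsilon$), then for all strategies $\sigma$ and all $i\ge 0$, $$\mathcal{M}^{\sigma}_i(T)\le 1-\epsilon_e.$$
   Context: An MDP is $\mathcal{M}=\langle Q,A,\delta\rangle$ with $Q$ finite set of states, $A$ finite set of actions, $\delta:Q\times A\to\mathcal{D}(Q)$ probabilistic transition function ($\mathcal{D}(Q)$ = probability distributions on $Q$). A (randomized) strategy is a function $\sigma:(QA)^*Q\to\mathcal{D}(A)$; with an initial distribution $d_0$ it induces a probability measure $\Pr^{\sigma}_{d_0}$ on infinite paths in the standard way. The distribution after $i$ steps is $\mathcal{M}^{\sigma}_i(q)=\Pr^{\sigma}_{d_0}(\text{the state at position } i \text{ is } q)$, with $\mathcal{M}^{\sigma}_0=d_0$; $d(T)=\sum_{q\in T}d(q)$. The smallest positive probability of $d_0$ is $\min\{d_0(q)\mid d_0(q)>0\}$. *)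

theory Defs
  imports "HOL-Probability.Probability"
begin

type_synonym ('q, 'a) mdp = "'q \<Rightarrow> 'a \<Rightarrow> 'q pmf"

text \<open>
  A history in \<open>(QA)\<^sup>*Q\<close> is split into the chronological list of past state-action pairs
  and the current state.
\<close>
type_synonym ('q, 'a) strategy = "('q \<times> 'a) list \<Rightarrow> 'q \<Rightarrow> 'a pmf"

text \<open>
  An infinite path \<open>q\<^sub>0 a\<^sub>0 q\<^sub>1 a\<^sub>1 \<dots>\<close> is the function \<open>\<lambda>i. (q\<^sub>i, a\<^sub>i)\<close>. The kernel below is the
  distribution of the pair at position \<open>i\<close>, given the pairs at the positions \<open>< i\<close>.
\<close>
definition path_kernel ::
  "('q, 'a) mdp \<Rightarrow> 'q pmf \<Rightarrow> ('q, 'a) strategy \<Rightarrow> nat \<Rightarrow> (nat \<Rightarrow> 'q \<times> 'a) \<Rightarrow> ('q \<times> 'a) pmf" where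
  "path_kernel \<delta> d0 \<sigma> i \<omega> =
     bind_pmf (if i = 0 then d0 else \<delta> (fst (\<omega> (i - 1))) (snd (\<omega> (i - 1))))
       (\<lambda>q. map_pmf (Pair q) (\<sigma> (map \<omega> [0..<i]) q))"

lemma Ionescu_Tulcea_path_kernel:
  fixes \<delta> :: "('q::finite, 'a::finite) mdp"
  shows "Ionescu_Tulcea (\<lambda>i \<omega>. measure_pmf (path_kernel \<delta> d0 \<sigma> i \<omega>)) (\<lambda>_. count_space UNIV)"
proof
  fix i :: nat
  have "PiM {0..<i} (\<lambda>_. count_space (UNIV :: ('q \<times> 'a) set))
      = count_space (PiE {0..<i} (\<lambda>_. UNIV))"
    by (rule count_space_PiM_finite) auto
  then show "(\<lambda>\<omega>. measure_pmf (path_kernel \<delta> d0 \<sigma> i \<omega>))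
      \<in> measurable (PiM {0..<i} (\<lambda>_. count_space UNIV)) (subprob_algebra (count_space UNIV))"
    by (auto simp: space_subprob_algebra intro!: measure_pmf.subprob_space_axioms)
qed

text \<open>The probability measure on infinite paths, by the Ionescu-Tulcea extension theorem.\<close>
definition path_measure ::
  "('q, 'a) mdp \<Rightarrow> 'q pmf \<Rightarrow> ('q, 'a) strategy \<Rightarrow> (nat \<Rightarrow> 'q \<times> 'a) measure" where
  "path_measure \<delta> d0 \<sigma> =
     projective_family.lim UNIV
       (Ionescu_Tulcea.CI (\<lambda>i \<omega>. measure_pmf (path_kernel \<delta> d0 \<sigma> i \<omega>)) (\<lambda>_. count_space UNIV))
       (\<lambda>_. count_space UNIV)"

lemma space_path_measure [simp]:
  fixes \<delta> :: "('q::finite, 'a::finite) mdp"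
  shows "space (path_measure \<delta> d0 \<sigma>) = UNIV"
proof -
  interpret Ionescu_Tulcea "\<lambda>i \<omega>. measure_pmf (path_kernel \<delta> d0 \<sigma> i \<omega>)" "\<lambda>_. count_space UNIV"
    by (rule Ionescu_Tulcea_path_kernel)
  show ?thesis
    by (simp add: path_measure_def space_PiM)
qed

lemma sets_path_measure [measurable_cong]:
  fixes \<delta> :: "('q::finite, 'a::finite) mdp"
  shows "sets (path_measure \<delta> d0 \<sigma>) = sets (PiM UNIV (\<lambda>_. count_space UNIV))"
proof -
  interpret Ionescu_Tulcea "\<lambda>i \<omega>. measure_pmf (path_kernel \<delta> d0 \<sigma> i \<omega>)" "\<lambda>_. count_space UNIV"
    by (rule Ionescu_Tulcea_path_kernel)
  show ?thesis
    by (simp add: path_measure_def)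
qed

lemma emeasure_path_measure_cylinder:
  fixes \<delta> :: "('q::finite, 'a::finite) mdp"
  shows "emeasure (path_measure \<delta> d0 \<sigma>) {\<omega>. \<forall>j<i. \<omega> j = \<rho> j}
      = (\<Prod>j<i. ennreal (pmf (path_kernel \<delta> d0 \<sigma> j \<rho>) (\<rho> j)))"
proof -
  let ?P = "\<lambda>i \<omega>. measure_pmf (path_kernel \<delta> d0 \<sigma> i \<omega>)"
  let ?M = "\<lambda>_::nat. count_space (UNIV :: ('q \<times> 'a) set)"
  interpret Ionescu_Tulcea ?P ?M
    by (rule Ionescu_Tulcea_path_kernel)
  have PiM_eq: "PiM {0..<n} ?M = count_space (PiE {0..<n} (\<lambda>_. UNIV))" for n :: nat
    by (rule count_space_PiM_finite) auto
  have in_PiE: "restrict \<rho> {0..<n} \<in> PiE {0..<n} (\<lambda>_. UNIV)" for n :: nat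
    by auto
  have C: "emeasure (C 0 n (\<lambda>_. undefined)) {restrict \<rho> {0..<n}}
      = (\<Prod>j<n. ennreal (pmf (path_kernel \<delta> d0 \<sigma> j \<rho>) (\<rho> j)))" for n
  proof (induction n)
    case 0
    have "restrict \<rho> {0..<0::nat} = (\<lambda>_. undefined)" by (auto simp: fun_eq_iff)
    then show ?case
      using PiM_eq[of 0] by (subst C.simps(1), subst emeasure_return) auto
  next
    case (Suc n)
    let ?r = "restrict \<rho> {0..<n}" and ?r' = "restrict \<rho> {0..<Suc n}"
    have [measurable]: "{?r'} \<in> sets (PiM {0..<Suc n} ?M)"
      using in_PiE[of "Suc n"] by (simp add: PiM_eq)
    have sp: "space (C 0 n (\<lambda>_. undefined)) = PiE {0..<n} (\<lambda>_. UNIV)"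
      using space_C[of "\<lambda>_. undefined" 0 n] by (simp add: space_PiM)
    have k: "path_kernel \<delta> d0 \<sigma> n ?r = path_kernel \<delta> d0 \<sigma> n \<rho>"
    proof -
      have "map ?r [0..<n] = map \<rho> [0..<n]" by auto
      moreover have "?r (n - 1) = \<rho> (n - 1)" if "n \<noteq> 0" using that by auto
      ultimately show ?thesis unfolding path_kernel_def by (simp only: refl if_True if_False split: if_split) auto
    qed
    have e: "emeasure (eP n \<omega>) {?r'}
        = ennreal (pmf (path_kernel \<delta> d0 \<sigma> n \<rho>) (\<rho> n)) * indicator {?r} \<omega>"
      if \<omega>: "\<omega> \<in> PiE {0..<n} (\<lambda>_. UNIV)" for \<omega>
    proof -
      have "emeasure (eP n \<omega>) {?r'} = emeasure (?P n \<omega>) ((\<lambda>x. fun_upd \<omega> n x) -` {?r'})"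
        using emeasure_eP[of \<omega> n "{?r'}"] \<omega> by (simp add: space_PiM)
      also have "(\<lambda>x. fun_upd \<omega> n x) -` {?r'} = (if \<omega> = ?r then {\<rho> n} else {})"
      proof -
        have "fun_upd \<omega> n x = ?r' \<longleftrightarrow> \<omega> = ?r \<and> x = \<rho> n" for x
        proof
          assume eq: "fun_upd \<omega> n x = ?r'"
          have "\<omega> j = ?r j" for j
            using fun_cong[OF eq, of j] \<omega> by (cases "j = n") (auto simp: PiE_iff extensional_def less_Suc_eq)
          moreover have "x = \<rho> n"
            using fun_cong[OF eq, of n] by simp
          ultimately show "\<omega> = ?r \<and> x = \<rho> n" by auto
        qed (auto simp: fun_eq_iff less_Suc_eq)
        then show ?thesis by (cases "\<omega> = ?r") (simp_all add: vimage_def)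
      qed
      finally show ?thesis
        by (cases "\<omega> = ?r") (simp_all add: k emeasure_pmf_single del: restrict_apply)
    qed
    have "emeasure (C 0 (Suc n) (\<lambda>_. undefined)) {?r'}
        = (\<integral>\<^sup>+\<omega>. emeasure (eP n \<omega>) {?r'} \<partial>C 0 n (\<lambda>_. undefined))"
      unfolding C.simps(2) add_0
      by (rule emeasure_bind[where N = "PiM {0..<Suc n} ?M"])
         (use sp measurable_eP[of n] sets_C[of "\<lambda>_. undefined" 0 n] in
           \<open>auto simp: space_PiM cong: measurable_cong_sets\<close>)
    also have "\<dots> = (\<integral>\<^sup>+\<omega>. ennreal (pmf (path_kernel \<delta> d0 \<sigma> n \<rho>) (\<rho> n)) * indicator {?r} \<omega>
        \<partial>C 0 n (\<lambda>_. undefined))"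
      by (rule nn_integral_cong) (use sp e in auto)
    also have "\<dots> = ennreal (pmf (path_kernel \<delta> d0 \<sigma> n \<rho>) (\<rho> n))
        * emeasure (C 0 n (\<lambda>_. undefined)) {?r}"
      by (rule nn_integral_cmult_indicator)
         (use in_PiE[of n] sets_C[of "\<lambda>_. undefined" 0 n] in \<open>simp add: space_PiM PiM_eq\<close>)
    finally show ?case
      by (simp add: Suc.IH mult.commute del: restrict_apply)
  qed
  have cyl: "{\<omega>. \<forall>j<i. \<omega> j = \<rho> j} = PF.emb UNIV {0..<i} {restrict \<rho> {0..<i}}"
    by (auto simp: prod_emb_def space_PiM fun_eq_iff restrict_def) metis
  have S: "{restrict \<rho> {0..<i}} \<in> sets (PiM {0..<i} ?M)"
    by (simp add: PiM_eq)
  have "emeasure (path_measure \<delta> d0 \<sigma>) {\<omega>. \<forall>j<i. \<omega> j = \<rho> j}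
      = emeasure (CI {0..<i}) {restrict \<rho> {0..<i}}"
    unfolding path_measure_def cyl by (rule lim[OF _ S]) simp
  also have "\<dots> = emeasure (C 0 i (\<lambda>_. undefined)) {restrict \<rho> {0..<i}}"
  proof -
    have "PF.emb {0..<i} {0..<i} {restrict \<rho> {0..<i}} = {restrict \<rho> {0..<i}}"
      by (rule prod_emb_id) (simp add: space_PiM)
    then show ?thesis
      using emeasure_CI[OF _ S, of i] by simp
  qed
  finally show ?thesis
    by (simp add: C)
qed

definition state_prob ::
  "('q, 'a) mdp \<Rightarrow> 'q pmf \<Rightarrow> ('q, 'a) strategy \<Rightarrow> nat \<Rightarrow> 'q \<Rightarrow> real" where
  "state_prob \<delta> d0 \<sigma> i q =
     measure (path_measure \<delta> d0 \<sigma>) {\<omega> \<in> space (path_measure \<delta> d0 \<sigma>). fst (\<omega> i) = q}"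

definition mass :: "('q \<Rightarrow> real) \<Rightarrow> 'q set \<Rightarrow> real" where
  "mass d T = (\<Sum>q\<in>T. d q)"

definition limit_sure_eventually_sync :: "('q, 'a) mdp \<Rightarrow> 'q pmf \<Rightarrow> 'q set \<Rightarrow> bool" where
  "limit_sure_eventually_sync \<delta> d0 T \<longleftrightarrow>
     (\<forall>\<epsilon>>0. \<exists>\<sigma> i. mass (state_prob \<delta> d0 \<sigma> i) T \<ge> 1 - \<epsilon>)"

definition smallest_pos_prob :: "'q pmf \<Rightarrow> real" where
  "smallest_pos_prob d = Min {pmf d q | q. pmf d q > 0}"

definition smallest_pos_trans_prob :: "('q, 'a) mdp \<Rightarrow> real" where
  "smallest_pos_trans_prob \<delta> = Min {pmf (\<delta> q a) q' | q a q'. pmf (\<delta> q a) q' > 0}"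

end

theory Submission
  imports Defs
begin

text \<open>
  Let \<open>loss T m q\<close> be the least probability, over all strategies, of being outside \<open>T\<close> after \<open>m\<close>
  steps from \<open>q\<close>. The zero sets of \<open>loss T 0, loss T 1, \<dots>\<close> are subsets of a set with \<open>n\<close> elements,
  so two of them coincide, say at the indices \<open>k\<close> and \<open>k + r \<le> 2\<^sup>n\<close>; let \<open>R\<close> be this common
  set. Then \<open>loss R (m + j r)\<close> decreases in \<open>j\<close> to a limit \<open>L m\<close> that is \<open>r\<close>-periodic in \<open>m\<close>, and
  takes at most \<open>n r\<close> values. If \<open>0 < l < 1\<close> is such a value, then some successor of
  some pair of value \<open>l\<close> under an action optimal for \<open>L\<close> has a value greater than \<open>l\<close>: otherwise leaving
  the level set of \<open>l\<close>, which is necessary to reach \<open>R\<close>, has a fixed positive cost, and the finite-horizon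
  losses cannot converge to \<open>l\<close>. Hence \<open>l \<ge> \<alpha> l'\<close> for some value \<open>l' > l\<close>, and
  positive values are at least \<open>\<alpha> ^ (n r)\<close>. Finally \<open>loss T (k + m) \<ge> \<alpha> ^ k * loss R m\<close>.
\<close>

section \<open>Minimal losses\<close>

context
  fixes \<delta> :: "('q::finite, 'a::finite) mdp"
begin

definition post :: "('q \<Rightarrow> real) \<Rightarrow> 'q \<Rightarrow> 'a \<Rightarrow> real" where
  "post f q a = (\<Sum>q'\<in>UNIV. pmf (\<delta> q a) q' * f q')"

text \<open>The Bellman operator of a finite-horizon minimization problem.\<close>

definition best_post :: "('q \<Rightarrow> real) \<Rightarrow> 'q \<Rightarrow> real" where
  "best_post f q = Min (range (post f q))"

definition loss :: "'q set \<Rightarrow> nat \<Rightarrow> 'q \<Rightarrow> real" where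
  "loss X m = (best_post ^^ m) (indicator (- X))"

lemma loss_0: "loss X 0 = indicator (- X)"
  and loss_Suc: "loss X (Suc m) = best_post (loss X m)"
  by (simp_all add: loss_def)

lemma best_post_le: "best_post f q \<le> post f q a"
  unfolding best_post_def by (rule Min_le) auto

lemma best_post_attained: obtains a where "best_post f q = post f q a"
proof -
  have "best_post f q \<in> range (post f q)"
    unfolding best_post_def by (rule Min_in) auto
  then show thesis using that by auto
qed

lemma post_mono: "(\<And>q'. q' \<in> set_pmf (\<delta> q a) \<Longrightarrow> f q' \<le> g q') \<Longrightarrow> post f q a \<le> post g q a"
  unfolding post_def
  by (rule sum_mono) (metis mult_left_mono mult_zero_left pmf_nonneg set_pmf_iff order_refl)

lemma post_const: "post (\<lambda>_. c) q a = c"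
  by (simp add: post_def sum_pmf_eq_1 flip: sum_distrib_right)

lemma post_mult: "post (\<lambda>q'. c * f q') q a = c * post f q a"
  by (simp add: post_def sum_distrib_left algebra_simps)

text \<open>An action optimal for \<open>g\<close> is a competitor for \<open>f\<close>. The factor
  \<open>c\<close> lets bounds that hold only up to a power of \<alpha> pass through the
  operator.\<close>

lemma best_post_scaled_mono:
  assumes "\<And>q. c * f q \<le> g q" "0 \<le> c"
  shows "c * best_post f q \<le> best_post g q"
proof -
  obtain a where a: "best_post g q = post g q a"
    by (rule best_post_attained)
  have "c * best_post f q \<le> c * post f q a"
    using assms(2) by (intro mult_left_mono best_post_le)
  also have "\<dots> \<le> post g q a"
    unfolding post_mult[symmetric] by (rule post_mono) (rule assms(1))
  finally show ?thesis by (simp add: a)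
qed

lemma loss_range: "0 \<le> loss X m q \<and> loss X m q \<le> 1"
proof (induction m arbitrary: q)
  case 0
  show ?case by (simp add: loss_0 indicator_def)
next
  case (Suc m)
  obtain a where a: "best_post (loss X m) q = post (loss X m) q a"
    by (rule best_post_attained)
  have "post (\<lambda>_. 0) q a \<le> post (loss X m) q a" "post (loss X m) q a \<le> post (\<lambda>_. 1) q a"
    by (rule post_mono, simp add: Suc)+
  then show ?case by (simp add: loss_Suc a post_const)
qed

lemmas loss_nonneg = loss_range[THEN conjunct1] and loss_le_1 = loss_range[THEN conjunct2]

lemma loss_add_scaled_mono:
  assumes "\<And>q. c * loss X k q \<le> loss Y l q" "0 \<le> c"
  shows "c * loss X (k + m) q \<le> loss Y (l + m) q"
proof (induction m arbitrary: q)
  case 0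
  show ?case using assms by simp
next
  case (Suc m)
  show ?case
    using best_post_scaled_mono[OF Suc assms(2)] by (simp add: loss_Suc)
qed

section \<open>Lower bounds from the smallest transition probability\<close>

lemma finite_pos_trans_probs: "finite {pmf (\<delta> q a) q' | q a q'. pmf (\<delta> q a) q' > 0}"
  by (rule finite_subset[of _ "\<Union>q a. range (pmf (\<delta> q a))"]) auto

lemma trans_prob_ge: "0 < pmf (\<delta> q a) q' \<Longrightarrow> smallest_pos_trans_prob \<delta> \<le> pmf (\<delta> q a) q'"
proof -
  assume *: "0 < pmf (\<delta> q a) q'"
  show ?thesis
    unfolding smallest_pos_trans_prob_def using finite_pos_trans_probs * by (intro Min_le) auto
qed

lemma trans_prob_pos: "0 < smallest_pos_trans_prob \<delta>"
  and trans_prob_le_1: "smallest_pos_trans_prob \<delta> \<le> 1"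
proof -
  let ?A = "{pmf (\<delta> q a) q' | q a q'. pmf (\<delta> q a) q' > 0}"
  obtain q' where "q' \<in> set_pmf (\<delta> undefined undefined)"
    using set_pmf_not_empty by fast
  then have "pmf (\<delta> undefined undefined) q' \<in> ?A"
    using pmf_positive by fast
  then have "Min ?A \<in> ?A" using finite_pos_trans_probs by (intro Min_in) auto
  then show "0 < smallest_pos_trans_prob \<delta>" "smallest_pos_trans_prob \<delta> \<le> 1"
    unfolding smallest_pos_trans_prob_def by (auto simp: pmf_le_1)
qed

lemma post_ge:
  assumes "q' \<in> set_pmf (\<delta> q a)" "\<And>q'. 0 \<le> f q'"
  shows "smallest_pos_trans_prob \<delta> * f q' \<le> post f q a"
proof -
  have "smallest_pos_trans_prob \<delta> * f q' \<le> pmf (\<delta> q a) q' * f q'"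
    using assms by (intro mult_right_mono trans_prob_ge pmf_positive)
  also have "\<dots> \<le> post f q a"
    unfolding post_def by (rule member_le_sum) (use assms in auto)
  finally show ?thesis .
qed

lemma post_pos_witness:
  assumes "0 < post f q a"
  obtains q' where "q' \<in> set_pmf (\<delta> q a)" "0 < f q'"
  using post_mono[of q a f "\<lambda>_. 0"] assms by (force simp: post_const not_le)

text \<open>Under an optimal action a positive loss has a successor of positive loss, so each step
  costs at most one factor \<alpha>.\<close>

lemma pos_loss_ge: "0 < loss X m q \<Longrightarrow> smallest_pos_trans_prob \<delta> ^ m \<le> loss X m q"
proof (induction m arbitrary: q)
  case 0
  then show ?case by (simp add: loss_0 indicator_def split: if_splits)
next
  case (Suc m)
  obtain a where a: "best_post (loss X m) q = post (loss X m) q a"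
    by (rule best_post_attained)
  obtain q' where q': "q' \<in> set_pmf (\<delta> q a)" "0 < loss X m q'"
    using Suc.prems by (auto simp: loss_Suc a elim: post_pos_witness)
  have "smallest_pos_trans_prob \<delta> * smallest_pos_trans_prob \<delta> ^ m
      \<le> smallest_pos_trans_prob \<delta> * loss X m q'"
    using Suc.IH[OF q'(2)] trans_prob_pos by (intro mult_left_mono) auto
  also have "\<dots> \<le> post (loss X m) q a"
    using q' by (intro post_ge loss_nonneg)
  finally show ?case by (simp add: loss_Suc a)
qed

text \<open>The hypothesis amounts to \<open>loss R r \<le> loss R 0\<close> pointwise; applying
  \<open>best_post\<close> further shifts this comparison to every horizon.\<close>

lemma decseq_loss:
  assumes "\<And>q. q \<in> R \<Longrightarrow> loss R r q = 0"
  shows "decseq (\<lambda>j. loss R (m + j * r) q)"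
proof (rule decseq_SucI)
  fix j
  have "loss R r q \<le> loss R 0 q" for q
    using assms loss_le_1 by (simp add: loss_0 indicator_def)
  from loss_add_scaled_mono[of 1, simplified, OF this, of "m + j * r" q]
  show "loss R (m + Suc j * r) q \<le> loss R (m + j * r) q" by (simp add: ac_simps)
qed

section \<open>Periodic limits of losses\<close>

context
  fixes R :: "'q set" and r :: nat and L :: "nat \<Rightarrow> 'q \<Rightarrow> real"
  assumes r_pos: "0 < r"
    and R_recurrent: "\<And>q. q \<in> R \<Longrightarrow> loss R r q = 0"
    and L: "\<And>m q. (\<lambda>j. loss R (m + j * r) q) \<longlonglongrightarrow> L m q"
begin

lemma limit_le_loss: "L m q \<le> loss R m q"
  using decseq_ge[OF decseq_loss[OF R_recurrent] L, where n = 0] by simp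

lemma limit_range: "0 \<le> L m q" "L m q \<le> 1"
proof -
  show "0 \<le> L m q"
    by (rule LIMSEQ_le_const[OF L]) (auto simp: loss_nonneg)
  show "L m q \<le> 1"
    using limit_le_loss loss_le_1 order_trans by blast
qed

lemma limit_add_period: "L (m + r) = L m"
proof
  fix q
  have "(\<lambda>j. loss R (m + Suc j * r) q) \<longlonglongrightarrow> L m q"
    using L[of m q] by (rule LIMSEQ_Suc)
  moreover have "(\<lambda>j. loss R (m + Suc j * r) q) \<longlonglongrightarrow> L (m + r) q"
    using L[of "m + r" q] by (simp add: ac_simps)
  ultimately show "L (m + r) q = L m q"
    by (rule LIMSEQ_unique[rotated])
qed

lemma limit_mod: "L (m mod r) = L m"
proof -
  have "L (m + j * r) = L m" for m j
    by (induction j) (use limit_add_period[of "m + i * r" for i] in \<open>simp_all add: ac_simps\<close>)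
  from this[of "m mod r" "m div r"] show ?thesis by simp
qed

lemma range_limit: "range L = L ` {..<r}"
proof (rule equalityI)
  show "range L \<subseteq> L ` {..<r}"
  proof (rule image_subsetI)
    fix m
    show "L m \<in> L ` {..<r}"
      using r_pos by (intro image_eqI[of _ _ "m mod r"]) (simp_all add: limit_mod)
  qed
qed auto

text \<open>By periodicity only the pairs with \<open>m < r\<close> contribute values.\<close>

lemma finite_limit_values: "finite {L m q | m q. True}"
  and card_limit_values: "card {L m q | m q. True} \<le> CARD('q) * r"
proof -
  have eq: "{L m q | m q. True} = (\<lambda>(q, m). L m q) ` (UNIV \<times> {..<r})"
  proof safe
    fix m q
    show "L m q \<in> (\<lambda>(q, m). L m q) ` (UNIV \<times> {..<r})"
      using r_pos by (intro image_eqI[of _ _ "(q, m mod r)"]) (simp_all add: limit_mod)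
  qed auto
  show "finite {L m q | m q. True}" unfolding eq by auto
  show "card {L m q | m q. True} \<le> CARD('q) * r"
    unfolding eq using card_image_le[of "(UNIV :: 'q set) \<times> {..<r}"] by (simp add: card_cartesian_product)
qed

text \<open>The Bellman inequality survives the limit because \<open>post\<close> is a finite
  sum.\<close>

lemma limit_Suc_le_post: "L (Suc m) q \<le> post (L m) q a"
proof (rule LIMSEQ_le)
  show "(\<lambda>j. loss R (Suc m + j * r) q) \<longlonglongrightarrow> L (Suc m) q" by (rule L)
  show "(\<lambda>j. post (loss R (m + j * r)) q a) \<longlonglongrightarrow> post (L m) q a"
    unfolding post_def by (intro tendsto_intros L)
  show "\<exists>N. \<forall>j\<ge>N. loss R (Suc m + j * r) q \<le> post (loss R (m + j * r)) q a"
    by (simp add: loss_Suc best_post_le)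
qed

text \<open>Without such an exit, an action of mean \<open>l\<close> leads only to pairs of value
  \<open>l\<close>, and every other action costs at least a fixed \<open>c > l\<close>.
  Finite-horizon losses in the level set then stay at least \<open>c\<close>, against their
  convergence to \<open>l\<close>.\<close>

lemma level_set_exit:
  assumes l: "0 < l" "l < 1" and m: "L m q = l"
  obtains p m' a p' where "L (Suc m') p = l" "post (L m') p a = l" "p' \<in> set_pmf (\<delta> p a)" "l < L m' p'"
proof (rule ccontr)
  assume "\<not> thesis"
  note no_exit = this[unfolded not_def, rule_format, OF that]
  \<comment> \<open>\<open>D\<close> holds all one-step means of the limit functions. It is finite,
    so \<open>l\<close> is separated from the larger means.\<close>
  define D where "D = (\<Union>f\<in>range L. \<Union>p. range (post f p))"
  have "finite D"
    unfolding D_def range_limit by auto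
  \<comment> \<open>Inserting 1 makes the set nonempty and caps \<open>c\<close> by 1, which is the
    loss outside \<open>R\<close> at horizon 0.\<close>
  define c where "c = Min (insert 1 {d \<in> D. l < d})"
  have c: "l < c" "c \<le> 1"
    using \<open>finite D\<close> l by (auto simp: c_def)
  have c_le: "c \<le> post (L m) p a" if "l < post (L m) p a" for m p a
  proof -
    have "post (L m) p a \<in> D" by (auto simp: D_def)
    then show ?thesis
      unfolding c_def using that \<open>finite D\<close> by (intro Min_le) auto
  qed
  have "c \<le> loss R m p" if "L m p = l" for m p
    using that
  proof (induction m arbitrary: p)
    case 0
    then have "p \<notin> R"
      using limit_le_loss[of 0 p] l by (auto simp: loss_0)
    then show ?case using c by (simp add: loss_0)
  next
    case (Suc m)
    obtain a where a: "best_post (loss R m) p = post (loss R m) p a"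
      by (rule best_post_attained)
    have "c \<le> post (loss R m) p a"
    proof (cases "post (L m) p a = l")
      case False
      then have "c \<le> post (L m) p a"
        using limit_Suc_le_post[of m p a] Suc.prems by (intro c_le) simp
      also have "\<dots> \<le> post (loss R m) p a"
        by (intro post_mono limit_le_loss)
      finally show ?thesis .
    next
      case True
      \<comment> \<open>No successor exceeds \<open>l\<close>, while their mean is \<open>l\<close>;
        so all successors have value \<open>l\<close> and the induction hypothesis applies to
        them.\<close>
      have le: "L m p' \<le> l" if "p' \<in> set_pmf (\<delta> p a)" for p'
        using no_exit[OF Suc.prems True that] by (meson not_le)
      have eq: "L m p' = l" if "p' \<in> set_pmf (\<delta> p a)" for p'
      proof (rule ccontr)
        assume "L m p' \<noteq> l"
        then have "L m p' < l" using le that by force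
        have "post (L m) p a < post (\<lambda>_. l) p a"
          unfolding post_def
        proof (rule sum_strict_mono_ex1)
          show "\<forall>x\<in>UNIV. pmf (\<delta> p a) x * L m x \<le> pmf (\<delta> p a) x * l"
            using le by (metis mult_left_mono mult_zero_left pmf_nonneg set_pmf_iff order_refl)
          show "\<exists>x\<in>UNIV. pmf (\<delta> p a) x * L m x < pmf (\<delta> p a) x * l"
            using \<open>L m p' < l\<close> pmf_positive[OF that] by (auto intro!: exI[of _ p'])
        qed simp
        then show False using True by (simp add: post_const)
      qed
      have "post (\<lambda>_. c) p a \<le> post (loss R m) p a"
        by (intro post_mono Suc.IH eq)
      then show ?thesis by (simp add: post_const)
    qed
    then show ?case by (simp add: loss_Suc a)
  qed
  \<comment> \<open>Periodicity keeps \<open>q\<close> in the level set at all horizons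
    \<open>m + j * r\<close>.\<close>
  moreover have "L (m + j * r) q = l" for j
    using limit_mod[of "m + j * r"] limit_mod[of m] m by simp
  ultimately have "c \<le> loss R (m + j * r) q" for j by blast
  then have "c \<le> L m q"
    by (intro LIMSEQ_le_const[OF L]) auto
  then show False using c m by simp
qed

text \<open>Induction on the number of limit values above \<open>L m q\<close>. Below 1,
  \<open>level_set_exit\<close> gives a successor of larger value, hence with fewer values above it,
  at the price of one factor \<alpha>.\<close>

lemma pos_limit_ge_card:
  assumes "0 < L m q"
  shows "smallest_pos_trans_prob \<delta> ^ card {v \<in> {L m q | m q. True}. L m q < v} \<le> L m q"
  using assms
proof (induction "card {v \<in> {L m q | m q. True}. L m q < v}" arbitrary: m q rule: less_induct)
  case less
  let ?\<alpha> = "smallest_pos_trans_prob \<delta>"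
  let ?V = "\<lambda>l. {v \<in> {L m q | m q. True}. l < v}"
  show ?case
  proof (cases "L m q < 1")
    case False
    have "?\<alpha> ^ card (?V (L m q)) \<le> 1"
      using trans_prob_pos trans_prob_le_1 by (intro power_le_one) (auto intro: less_imp_le)
    then show ?thesis using False by linarith
  next
    case True
    obtain p m' a p' where p: "L (Suc m') p = L m q" "post (L m') p a = L m q"
      "p' \<in> set_pmf (\<delta> p a)" "L m q < L m' p'"
      using level_set_exit[OF less.prems True refl] .
    have "?V (L m' p') \<subset> ?V (L m q)"
      using p(4) by force
    then have card: "card (?V (L m' p')) < card (?V (L m q))"
      using finite_limit_values by (intro psubset_card_mono) auto
    have "?\<alpha> ^ card (?V (L m q)) \<le> ?\<alpha> ^ Suc (card (?V (L m' p')))"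
      using card trans_prob_pos trans_prob_le_1 by (intro power_decreasing) auto
    also have "\<dots> \<le> ?\<alpha> * L m' p'"
      using less.hyps[OF card] less.prems p(4) trans_prob_pos by simp
    also have "\<dots> \<le> L m q"
      using post_ge[OF p(3), of "L m'"] limit_range p(2) by simp
    finally show ?thesis .
  qed
qed

lemma pos_limit_ge:
  assumes "0 < L m q"
  shows "smallest_pos_trans_prob \<delta> ^ (CARD('q) * r) \<le> L m q"
proof -
  have "card {v \<in> {L m q | m q. True}. L m q < v} \<le> CARD('q) * r"
    by (rule order_trans[OF card_mono[OF finite_limit_values] card_limit_values]) auto
  then have "smallest_pos_trans_prob \<delta> ^ (CARD('q) * r)
      \<le> smallest_pos_trans_prob \<delta> ^ card {v \<in> {L m q | m q. True}. L m q < v}"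
    using trans_prob_pos trans_prob_le_1 by (intro power_decreasing) auto
  then show ?thesis using pos_limit_ge_card[OF assms] by linarith
qed

end

section \<open>An explicit bound at every horizon\<close>

lemma loss_zero_sets_repeat:
  obtains k r where "0 < r" "k + r \<le> 2 ^ CARD('q)" "{q. loss T (k + r) q = 0} = {q. loss T k q = 0}"
proof -
  let ?S = "\<lambda>k. {q. loss T k q = 0}"
  \<comment> \<open>Pigeonhole: \<open>2 ^ CARD('q) + 1\<close> indices, but only
    \<open>2 ^ CARD('q)\<close> sets of states.\<close>
  have "\<not> inj_on ?S {..2 ^ CARD('q)}"
  proof
    assume "inj_on ?S {..2 ^ CARD('q)}"
    then have "card {..2 ^ CARD('q) :: nat} \<le> card (UNIV :: 'q set set)"
      by (rule card_inj_on_le) auto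
    then show False by (simp add: card_UNIV_set)
  qed
  then obtain k l where "k < l" "l \<le> 2 ^ CARD('q)" "?S k = ?S l"
    unfolding inj_on_def by (metis atMost_iff linorder_neqE_nat)
  then show thesis using that[of "l - k" k] by simp
qed

text \<open>A gap \<epsilon> of unknown size, uniform over all horizons, becomes an explicit bound
  at the given \<open>i\<close>. Horizons below \<open>k\<close> are covered by
  \<open>pos_loss_ge\<close>, the others by the periodic limits for \<open>R\<close>.\<close>

lemma expected_loss_gap:
  assumes pos: "0 < \<epsilon>" "\<And>i. \<epsilon> \<le> (\<Sum>q\<in>UNIV. pmf d0 q * loss T i q)"
  obtains q where "q \<in> set_pmf d0"
    "smallest_pos_trans_prob \<delta> ^ ((CARD('q) + 1) * 2 ^ CARD('q)) \<le> loss T i q"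
proof -
  let ?n = "CARD('q)" and ?\<alpha> = "smallest_pos_trans_prob \<delta>"
  obtain k r where kr: "0 < r" "k + r \<le> 2 ^ ?n" "{q. loss T (k + r) q = 0} = {q. loss T k q = 0}"
    by (rule loss_zero_sets_repeat)
  have enough: thesis if "q \<in> set_pmf d0" "?\<alpha> ^ e \<le> loss T i q" "e \<le> (?n + 1) * 2 ^ ?n" for q e
  proof -
    have "?\<alpha> ^ ((?n + 1) * 2 ^ ?n) \<le> ?\<alpha> ^ e"
      using that trans_prob_pos trans_prob_le_1 by (intro power_decreasing) auto
    then show thesis using that by (intro \<open>\<And>q. _ \<Longrightarrow> _ \<Longrightarrow> thesis\<close>) auto
  qed
  show thesis
  proof (cases "i < k")
    case True
    have "\<exists>q\<in>set_pmf d0. 0 < loss T i q"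
    proof (rule ccontr)
      assume "\<not> ?thesis"
      then have "pmf d0 q * loss T i q = 0" for q
        using loss_nonneg[of T i q] by (force simp: set_pmf_iff)
      then have "(\<Sum>q\<in>UNIV. pmf d0 q * loss T i q) = 0" by (intro sum.neutral ballI)
      then show False using pos(1) pos(2)[of i] by simp
    qed
    then obtain q where q: "q \<in> set_pmf d0" "?\<alpha> ^ i \<le> loss T i q"
      using pos_loss_ge by auto
    moreover have "i \<le> (?n + 1) * 2 ^ ?n"
      using True kr(2) by (simp add: trans_le_add2)
    ultimately show thesis by (rule enough)
  next
    case False
    define m where "m = i - k"
    have i: "i = k + m" using False by (simp add: m_def)
    \<comment> \<open>\<open>R\<close> is the set of states from which some strategy is almost
      surely in \<open>T\<close> after \<open>k\<close> steps. Horizon \<open>k + m\<close> for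
      \<open>T\<close> is compared with horizon \<open>m\<close> for \<open>R\<close>.\<close>
    define R where "R = {q. loss T k q = 0}"
    have lower: "?\<alpha> ^ k * loss R m q \<le> loss T (k + m) q" for m q
    proof -
      have "?\<alpha> ^ k * loss R 0 q \<le> loss T k q" for q
        using pos_loss_ge[of T k q] loss_nonneg[of T k q]
        by (cases "q \<in> R") (auto simp: loss_0 R_def less_le)
      from loss_add_scaled_mono[OF this, of m q] show ?thesis
        using trans_prob_pos by simp
    qed
    have upper: "loss T (k + m) q \<le> loss R m q" for m q
    proof -
      have "loss T k q \<le> loss R 0 q" for q
        using loss_le_1 by (cases "q \<in> R") (auto simp: loss_0 R_def)
      from loss_add_scaled_mono[of 1, simplified, OF this, of m q] show ?thesis by simp
    qed
    \<comment> \<open>The zero set at \<open>k + r\<close> is \<open>R\<close> again, so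
      \<open>lower\<close> at horizon \<open>r\<close> leaves no positive loss on
      \<open>R\<close>.\<close>
    have rec: "loss R r q = 0" if "q \<in> R" for q
    proof -
      have "?\<alpha> ^ k * loss R r q \<le> 0"
        using lower[of r q] that unfolding R_def kr(3)[symmetric] by simp
      moreover have "0 < ?\<alpha> ^ k" using trans_prob_pos by simp
      ultimately show ?thesis
        using loss_nonneg[of R r q] by (simp add: mult_le_0_iff)
    qed
    have "\<exists>l. (\<lambda>j. loss R (m + j * r) q) \<longlonglongrightarrow> l" for m q
    proof -
      have "decseq (\<lambda>j. loss R (m + j * r) q)"
        by (rule decseq_loss) (rule rec)
      then show ?thesis
        using decseq_convergent[of _ 0] loss_nonneg by metis
    qed
    then obtain L where L: "\<And>m q. (\<lambda>j. loss R (m + j * r) q) \<longlonglongrightarrow> L m q" by metis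
    note L_ctx = kr(1) rec L
    \<comment> \<open>If the limit vanished on the support of \<open>d0\<close>, the mean of
      \<open>loss R (m + j * r)\<close> would tend to 0, while \<open>upper\<close> keeps it at
      least \<epsilon>.\<close>
    have "\<exists>q\<in>set_pmf d0. 0 < L m q"
    proof (rule ccontr)
      assume "\<not> ?thesis"
      then have zero: "pmf d0 q * L m q = 0" for q
        using limit_range(1)[OF L_ctx, of m q] by (force simp: set_pmf_iff)
      have "(\<lambda>j. \<Sum>q\<in>UNIV. pmf d0 q * loss R (m + j * r) q) \<longlonglongrightarrow> (\<Sum>q\<in>UNIV. pmf d0 q * L m q)"
        by (intro tendsto_intros L)
      moreover have "\<epsilon> \<le> (\<Sum>q\<in>UNIV. pmf d0 q * loss R (m + j * r) q)" for j
      proof -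
        have "(\<Sum>q\<in>UNIV. pmf d0 q * loss T (k + (m + j * r)) q)
            \<le> (\<Sum>q\<in>UNIV. pmf d0 q * loss R (m + j * r) q)"
          by (intro sum_mono mult_left_mono upper) simp
        with pos(2) show ?thesis by (rule order_trans)
      qed
      ultimately have "\<epsilon> \<le> (\<Sum>q\<in>UNIV. pmf d0 q * L m q)"
        by (intro LIMSEQ_le_const) auto
      then show False using pos(1) zero by simp
    qed
    then obtain q where q: "q \<in> set_pmf d0" "0 < L m q" by blast
    \<comment> \<open>The exponent \<open>k\<close> pays for passing from \<open>T\<close> to
      \<open>R\<close>, and \<open>?n * r\<close> for the limit value; both \<open>k\<close> and
      \<open>r\<close> are at most \<open>2 ^ ?n\<close>.\<close>
    have "?\<alpha> ^ (k + ?n * r) = ?\<alpha> ^ k * ?\<alpha> ^ (?n * r)"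
      by (rule power_add)
    also have "\<dots> \<le> ?\<alpha> ^ k * loss R m q"
      using pos_limit_ge[OF L_ctx q(2)] limit_le_loss[OF L_ctx, of m q] trans_prob_pos
      by (intro mult_left_mono) auto
    also have "\<dots> \<le> loss T i q"
      using lower by (simp add: i)
    finally have "?\<alpha> ^ (k + ?n * r) \<le> loss T i q" .
    moreover have "k + ?n * r \<le> (?n + 1) * 2 ^ ?n"
    proof -
      have "?n * r \<le> ?n * 2 ^ ?n"
        using kr(2) by (intro mult_le_mono2) simp
      moreover have "k \<le> 2 ^ ?n"
        using kr(2) by simp
      moreover have "(?n + 1) * 2 ^ ?n = ?n * 2 ^ ?n + 2 ^ ?n"
        by simp
      ultimately show ?thesis by linarith
    qed
    ultimately show thesis by (rule enough[OF q(1)])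
  qed
qed

section \<open>Losses and the path measure\<close>

definition next_state :: "'q pmf \<Rightarrow> ('q \<times> 'a) list \<Rightarrow> 'q pmf" where
  "next_state d0 h = (if h = [] then d0 else \<delta> (fst (last h)) (snd (last h)))"

text \<open>Indexing cylinders by finite lists turns probabilities at a fixed time into finite
  sums.\<close>

definition hist_prob :: "'q pmf \<Rightarrow> ('q, 'a) strategy \<Rightarrow> ('q \<times> 'a) list \<Rightarrow> real" where
  "hist_prob d0 \<sigma> h = measure (path_measure \<delta> d0 \<sigma>) {\<omega>. map \<omega> [0..<length h] = h}"

text \<open>The kernel sees only the list of earlier pairs: its last entry is
  \<open>\<omega> (i - 1)\<close>, and the empty list selects \<open>d0\<close>.\<close>

lemma path_kernel_eq:
  "path_kernel \<delta> d0 \<sigma> i \<omega> = bind_pmf (next_state d0 (map \<omega> [0..<i])) (\<lambda>q. map_pmf (Pair q) (\<sigma> (map \<omega> [0..<i]) q))"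
  by (cases i) (simp_all add: path_kernel_def next_state_def)

lemma pmf_bind_map_Pair:
  "pmf (bind_pmf p (\<lambda>q. map_pmf (Pair q) (s q))) (q :: 'q, a) = pmf p q * pmf (s q) a"
proof -
  have "pmf (map_pmf (Pair x) (s x)) (q, a) = indicator {q} x * pmf (s q) a" for x
  proof (cases "x = q")
    case True
    then show ?thesis by (simp add: pmf_map_inj' inj_on_def)
  next
    case False
    then show ?thesis by (auto simp: pmf_eq_0_set_pmf)
  qed
  then show ?thesis
    by (simp add: pmf_bind integral_measure_pmf_real[of UNIV] indicator_def sum.delta if_distrib mult.commute
        cong: if_cong)
qed

lemma hist_prob_map:
  "hist_prob d0 \<sigma> (map \<rho> [0..<i]) = (\<Prod>j<i. pmf (path_kernel \<delta> d0 \<sigma> j \<rho>) (\<rho> j))"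
proof -
  have "{\<omega>. map \<omega> [0..<i] = map \<rho> [0..<i]} = {\<omega>. \<forall>j<i. \<omega> j = \<rho> j}" by auto
  then show ?thesis
    by (simp add: hist_prob_def measure_def emeasure_path_measure_cylinder prod_ennreal prod_nonneg)
qed

lemma hist_prob_nonneg: "0 \<le> hist_prob d0 \<sigma> h"
  by (simp add: hist_prob_def)

lemma hist_prob_Nil: "hist_prob d0 \<sigma> [] = 1"
  using hist_prob_map[of d0 \<sigma> undefined 0] by simp

lemma hist_prob_snoc:
  "hist_prob d0 \<sigma> (h @ [(q, a)]) = hist_prob d0 \<sigma> h * pmf (next_state d0 h) q * pmf (\<sigma> h q) a"
proof -
  define \<rho> where "\<rho> j = (h @ [(q, a)]) ! j" for j
  have h: "h = map \<rho> [0..<length h]"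
    by (rule nth_equalityI) (auto simp: \<rho>_def nth_append)
  have hx: "h @ [(q, a)] = map \<rho> [0..<Suc (length h)]"
    using h by (simp add: \<rho>_def)
  have "\<rho> (length h) = (q, a)" by (simp add: \<rho>_def)
  then have "pmf (path_kernel \<delta> d0 \<sigma> (length h) \<rho>) (\<rho> (length h))
      = pmf (next_state d0 h) q * pmf (\<sigma> h q) a"
    using path_kernel_eq[of d0 \<sigma> "length h" \<rho>, folded h] by (simp add: pmf_bind_map_Pair)
  moreover have "hist_prob d0 \<sigma> (h @ [(q, a)])
      = hist_prob d0 \<sigma> h * pmf (path_kernel \<delta> d0 \<sigma> (length h) \<rho>) (\<rho> (length h))"
    using hist_prob_map[of d0 \<sigma> \<rho> "length h", folded h] hist_prob_map[of d0 \<sigma> \<rho> "Suc (length h)", folded hx]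
    by simp
  ultimately show ?thesis by simp
qed

lemma finite_lists_length: "finite {h :: ('q \<times> 'a) list. length h = t}"
  using finite_lists_length_eq[of "UNIV :: ('q \<times> 'a) set" t] by simp

lemma sum_lists_Suc:
  fixes g :: "('q \<times> 'a) list \<Rightarrow> real"
  shows "sum g {h. length h = Suc t}
    = (\<Sum>h | length h = t. \<Sum>q\<in>UNIV. \<Sum>a\<in>UNIV. g (h @ [(q, a)]))"
proof -
  let ?S = "\<lambda>t. {h :: ('q \<times> 'a) list. length h = t}"
  have "?S (Suc t) = (\<lambda>(h, x). h @ [x]) ` (?S t \<times> UNIV)"
    by (force simp: image_iff length_Suc_conv_rev)
  moreover have "inj_on (\<lambda>(h, x). h @ [x]) (?S t \<times> (UNIV :: ('q \<times> 'a) set))"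
    by (auto simp: inj_on_def)
  ultimately have "sum g (?S (Suc t)) = (\<Sum>(h, x)\<in>?S t \<times> UNIV. g (h @ [x]))"
    by (simp add: sum.reindex case_prod_unfold)
  also have "\<dots> = (\<Sum>h\<in>?S t. \<Sum>x\<in>UNIV. g (h @ [x]))"
    by (rule sum.cartesian_product[symmetric])
  also have "\<dots> = (\<Sum>h\<in>?S t. \<Sum>q\<in>UNIV. \<Sum>a\<in>UNIV. g (h @ [(q, a)]))"
    by (simp add: sum.cartesian_product)
  finally show ?thesis .
qed

lemma hist_event_eq:
  "{\<omega> :: nat \<Rightarrow> 'q \<times> 'a. map \<omega> [0..<length h] = h} = {\<omega>. \<forall>j<length h. \<omega> j = h ! j}"
  unfolding list_eq_iff_nth_eq by simp

lemma sets_hist_event: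
  "{\<omega>. map \<omega> [0..<length h] = h} \<in> sets (path_measure \<delta> d0 \<sigma>)"
proof -
  have "{\<omega> \<in> space (path_measure \<delta> d0 \<sigma>). \<forall>j<length h. \<omega> j = h ! j} \<in> sets (path_measure \<delta> d0 \<sigma>)"
    by measurable
  then show ?thesis by (simp add: hist_event_eq)
qed

text \<open>The event is a finite disjoint union of cylinders; summing out the last action leaves
  the law of the state.\<close>

lemma state_prob_eq_sum:
  "state_prob \<delta> d0 \<sigma> i q = (\<Sum>h | length h = i. hist_prob d0 \<sigma> h * pmf (next_state d0 h) q)"
proof -
  let ?M = "path_measure \<delta> d0 \<sigma>"
  \<comment> \<open>The length is \<open>Suc i\<close> because the state at position
    \<open>i\<close> sits in the pair with index \<open>i\<close>.\<close>
  let ?H = "{h :: ('q \<times> 'a) list. length h = Suc i \<and> fst (last h) = q}"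
  let ?C = "\<lambda>h. {\<omega> :: nat \<Rightarrow> 'q \<times> 'a. map \<omega> [0..<length h] = h}"
  have "{\<omega> \<in> space ?M. fst (\<omega> i) = q} = (\<Union>h\<in>?H. ?C h)"
    by (auto intro!: exI[of _ "map _ [0..<Suc i]"])
  then have "state_prob \<delta> d0 \<sigma> i q = measure ?M (\<Union>h\<in>?H. ?C h)"
    by (simp add: state_prob_def)
  also have "\<dots> = (\<Sum>h\<in>?H. measure ?M (?C h))"
  proof (rule measure_finite_Union)
    show "finite ?H" by (rule finite_subset[OF _ finite_lists_length[of "Suc i"]]) auto
    show "?C ` ?H \<subseteq> sets ?M"
      using sets_hist_event by blast
    show "disjoint_family_on ?C ?H"
      by (auto simp: disjoint_family_on_def)
    show "emeasure ?M (?C h) \<noteq> \<infinity>" for h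
      by (simp add: hist_event_eq emeasure_path_measure_cylinder prod_ennreal)
  qed
  also have "\<dots> = (\<Sum>h | length h = Suc i. if fst (last h) = q then hist_prob d0 \<sigma> h else 0)"
    unfolding hist_prob_def[symmetric]
    using sum.inter_filter[OF finite_lists_length[of "Suc i"], of "hist_prob d0 \<sigma>" "\<lambda>h. fst (last h) = q"]
    by simp
  also have "\<dots> = (\<Sum>h | length h = i. hist_prob d0 \<sigma> h * pmf (next_state d0 h) q)"
    unfolding sum_lists_Suc
  proof (rule sum.cong[OF refl])
    fix h :: "('q \<times> 'a) list"
    have "(\<Sum>p\<in>UNIV. \<Sum>a\<in>UNIV. if fst (last (h @ [(p, a)])) = q then hist_prob d0 \<sigma> (h @ [(p, a)]) else 0)
        = (\<Sum>p\<in>UNIV. if p = q then \<Sum>a\<in>UNIV. hist_prob d0 \<sigma> (h @ [(p, a)]) else 0)"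
      by (intro sum.cong) auto
    also have "\<dots> = (\<Sum>a\<in>UNIV. hist_prob d0 \<sigma> (h @ [(q, a)]))"
      by simp
    also have "\<dots> = hist_prob d0 \<sigma> h * pmf (next_state d0 h) q"
      by (simp add: hist_prob_snoc sum_pmf_eq_1 flip: sum_distrib_left)
    finally show "(\<Sum>p\<in>UNIV. \<Sum>a\<in>UNIV. if fst (last (h @ [(p, a)])) = q then hist_prob d0 \<sigma> (h @ [(p, a)]) else 0)
        = hist_prob d0 \<sigma> h * pmf (next_state d0 h) q" .
  qed
  finally show ?thesis .
qed

section \<open>Expectations at a fixed time and optimal strategies\<close>

definition expected :: "'q pmf \<Rightarrow> ('q, 'a) strategy \<Rightarrow> nat \<Rightarrow> ('q \<Rightarrow> real) \<Rightarrow> real" where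
  "expected d0 \<sigma> t f =
     (\<Sum>h | length h = t. \<Sum>q\<in>UNIV. hist_prob d0 \<sigma> h * pmf (next_state d0 h) q * f q)"

lemma expected_0: "expected d0 \<sigma> 0 f = (\<Sum>q\<in>UNIV. pmf d0 q * f q)"
  by (simp add: expected_def hist_prob_Nil next_state_def)

text \<open>Tower property: condition on the history and state at time \<open>t\<close>, then
  average over the action and the successor.\<close>

lemma expected_Suc:
  "expected d0 \<sigma> (Suc t) f = (\<Sum>h | length h = t. \<Sum>q\<in>UNIV.
     hist_prob d0 \<sigma> h * pmf (next_state d0 h) q * (\<Sum>a\<in>UNIV. pmf (\<sigma> h q) a * post f q a))"
  by (simp add: expected_def sum_lists_Suc hist_prob_snoc post_def next_state_def sum_distrib_left mult.assoc)

lemma mass_state_prob: "mass (state_prob \<delta> d0 \<sigma> i) X = expected d0 \<sigma> i (indicator X)"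
proof -
  have "expected d0 \<sigma> i (indicator X) = (\<Sum>q\<in>UNIV. state_prob \<delta> d0 \<sigma> i q * indicator X q)"
    unfolding expected_def state_prob_eq_sum sum_distrib_right by (rule sum.swap)
  also have "\<dots> = mass (state_prob \<delta> d0 \<sigma> i) X"
    by (simp add: mass_def indicator_def sum.If_cases if_distrib cong: if_cong)
  finally show ?thesis by simp
qed

lemma expected_const: "expected d0 \<sigma> i (\<lambda>_. c) = c"
proof (induction i)
  case 0
  show ?case by (simp add: expected_0 sum_pmf_eq_1 flip: sum_distrib_right)
next
  case (Suc i)
  have "(\<Sum>a\<in>UNIV. pmf (\<sigma> h q) a * c) = c" for h q
    by (simp add: sum_pmf_eq_1 flip: sum_distrib_right)
  then show ?case
    using Suc by (simp add: expected_Suc post_const) (simp add: expected_def)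
qed

lemma mass_state_prob_compl: "mass (state_prob \<delta> d0 \<sigma> i) X = 1 - expected d0 \<sigma> i (loss X 0)"
proof -
  have "expected d0 \<sigma> i (indicator X) + expected d0 \<sigma> i (indicator (- X)) = expected d0 \<sigma> i (\<lambda>_. 1)"
    unfolding expected_def sum.distrib[symmetric]
    by (intro sum.cong) (auto simp: indicator_def)
  then show ?thesis
    by (simp add: mass_state_prob expected_const loss_0)
qed

text \<open>Averaging over a randomized choice of action cannot go below the minimum over
  actions.\<close>

lemma expected_best_post_le: "expected d0 \<sigma> t (best_post f) \<le> expected d0 \<sigma> (Suc t) f"
proof -
  have "best_post f q \<le> (\<Sum>a\<in>UNIV. pmf s a * post f q a)" for q and s :: "'a pmf"
  proof -
    have "best_post f q = (\<Sum>a\<in>UNIV. pmf s a * best_post f q)"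
      by (simp add: sum_pmf_eq_1 flip: sum_distrib_right)
    also have "\<dots> \<le> (\<Sum>a\<in>UNIV. pmf s a * post f q a)"
      by (intro sum_mono mult_left_mono best_post_le) simp
    finally show ?thesis .
  qed
  then show ?thesis
    unfolding expected_Suc unfolding expected_def
    by (intro sum_mono mult_left_mono) (auto simp: hist_prob_nonneg)
qed

text \<open>Optimality of \<open>loss\<close>, first half: iterating the one-step bound shows that
  no strategy does better.\<close>

lemma expected_loss_le: "(\<Sum>q\<in>UNIV. pmf d0 q * loss X i q) \<le> expected d0 \<sigma> i (loss X 0)"
proof -
  have "expected d0 \<sigma> 0 (loss X (t + j)) \<le> expected d0 \<sigma> t (loss X j)" for t j
  proof (induction t arbitrary: j)
    case (Suc t)
    show ?case
      using Suc[of "Suc j"] expected_best_post_le[of d0 \<sigma> t "loss X j"] by (simp add: loss_Suc)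
  qed simp
  from this[of i 0] show ?thesis by (simp add: expected_0)
qed

text \<open>Second half: a deterministic strategy that depends only on the time and the current
  state reaches the bound.\<close>

lemma expected_loss_attained:
  obtains \<sigma> where "expected d0 \<sigma> i (loss X 0) = (\<Sum>q\<in>UNIV. pmf d0 q * loss X i q)"
proof -
  have "\<exists>a. best_post f q = post f q a" for f q
    by (rule best_post_attained) blast
  then obtain b where b: "\<And>f q. best_post f q = post f q (b f q)"
    by metis
  \<comment> \<open>After the action chosen at history \<open>h\<close>,
    \<open>i - Suc (length h)\<close> steps remain; the action minimizes the loss for that
    horizon.\<close>
  define \<sigma> :: "('q, 'a) strategy"
    where "\<sigma> h q = return_pmf (b (loss X (i - Suc (length h))) q)" for h q
  \<comment> \<open>The expected loss over the remaining steps is invariant along this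
    strategy.\<close>
  have "expected d0 \<sigma> t (loss X (i - t)) = expected d0 \<sigma> 0 (loss X i)" if "t \<le> i" for t
    using that
  proof (induction t)
    case (Suc t)
    have "expected d0 \<sigma> (Suc t) (loss X (i - Suc t)) = expected d0 \<sigma> t (best_post (loss X (i - Suc t)))"
      unfolding expected_Suc unfolding expected_def
      by (intro sum.cong) (auto simp: \<sigma>_def b indicator_def pmf_return if_distrib cong: if_cong)
    also have "best_post (loss X (i - Suc t)) = loss X (i - t)"
      using Suc.prems by (simp add: Suc_diff_Suc flip: loss_Suc)
    finally show ?case using Suc by simp
  qed simp
  from this[of i] have "expected d0 \<sigma> i (loss X 0) = (\<Sum>q\<in>UNIV. pmf d0 q * loss X i q)"
    by (simp add: expected_0)
  then show thesis by (rule that)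
qed

end

lemma smallest_pos_prob_le:
  fixes d :: "'q::finite pmf"
  assumes "q \<in> set_pmf d"
  shows "smallest_pos_prob d \<le> pmf d q"
proof -
  have "finite {pmf d q | q. pmf d q > 0}"
    by (rule finite_subset[of _ "range (pmf d)"]) auto
  then show ?thesis
    unfolding smallest_pos_prob_def using pmf_positive[OF assms] by (intro Min_le) auto
qed

theorem theorem1:
  fixes \<delta> :: "('q::finite, 'a::finite) mdp"
    and T :: "'q set"
    and d0 :: "'q pmf"
    and n :: nat
    and \<alpha> \<alpha>0 \<epsilon>e :: real
  assumes "n = CARD('q)"
    and "\<alpha> = smallest_pos_trans_prob \<delta>"
    and "\<alpha>0 = smallest_pos_prob d0"
    and "\<epsilon>e = \<alpha>0 * \<alpha> ^ ((n + 1) * 2 ^ n)"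
    and "\<not> limit_sure_eventually_sync \<delta> d0 T"
  shows "\<forall>\<sigma> i. mass (state_prob \<delta> d0 \<sigma> i) T \<le> 1 - \<epsilon>e"
proof (intro allI)
  fix \<sigma> i
  obtain \<epsilon> where "0 < \<epsilon>" and below: "\<And>\<sigma> i. mass (state_prob \<delta> d0 \<sigma> i) T < 1 - \<epsilon>"
    using assms(5) by (auto simp: limit_sure_eventually_sync_def not_le)
  \<comment> \<open>The gap holds for every strategy, in particular for an optimal one at each
    horizon.\<close>
  have "\<epsilon> \<le> (\<Sum>q\<in>UNIV. pmf d0 q * loss \<delta> T i q)" for i
  proof -
    obtain \<sigma> where "expected \<delta> d0 \<sigma> i (loss \<delta> T 0) = (\<Sum>q\<in>UNIV. pmf d0 q * loss \<delta> T i q)"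
      by (rule expected_loss_attained)
    then show ?thesis
      using below[of \<sigma> i] by (simp add: mass_state_prob_compl)
  qed
  from expected_loss_gap[OF \<open>0 < \<epsilon>\<close> this, of i]
  obtain q where q: "q \<in> set_pmf d0" "\<alpha> ^ ((n + 1) * 2 ^ n) \<le> loss \<delta> T i q"
    unfolding assms(1,2) .
  \<comment> \<open>The single state \<open>q\<close> of the support already accounts for the whole
    bound: \<open>\<alpha>0\<close> from its initial weight and the power of \<alpha> from its
    loss.\<close>
  have "\<epsilon>e \<le> pmf d0 q * loss \<delta> T i q"
    unfolding assms(3,4)
    using q trans_prob_pos[of \<delta>] by (intro mult_mono smallest_pos_prob_le) (auto simp: assms(2))
  also have "\<dots> \<le> (\<Sum>q\<in>UNIV. pmf d0 q * loss \<delta> T i q)"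
    by (rule member_le_sum) (auto simp: loss_nonneg)
  also have "\<dots> \<le> expected \<delta> d0 \<sigma> i (loss \<delta> T 0)"
    by (rule expected_loss_le)
  finally show "mass (state_prob \<delta> d0 \<sigma> i) T \<le> 1 - \<epsilon>e"
    by (simp add: mass_state_prob_compl)
qed

end
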